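(* Let $q^2\neq 0$ and $\lambda$ be real parameters and let $S_{q,\lambda}$ be the $q$-fuzzy sphere, i.e. the unital $*$-algebra over $\mathbb{C}$ with generators $a=a^*,\ b,\ b^*$ and relations $$q^2ab-ba=\lambda b,\qquad bb^*=(q^2a-\lambda)(1+\lambda-q^2a),\qquad b^*b=a(1-a).$$ Then, as a $*$-algebra, $S_{q,\lambda}$ is: (1) isomorphic to the fuzzy sphere (with parameter $\lambda$) if $q^2=1$; (2) isomorphic to the standard $q$-sphere if $\lambda=0$ or $\lambda=q^2-1$; (3) isomorphic to the nonstandard Podleś sphere with parameters $(q^2,s^2)$ if $q^2\neq 1$ and $\lambda\neq 0,\ q^2-1$, where $$s^2=\frac{\lambda}{q^2-1-\lambda}$$ (so $s$ is real only if $\lambda$ lies between $0$ and $q^2-1$); (4) invariant under $\lambda\mapsto q^2-1-\lambda$ up to the isomorphism given on generators by $b\mapsto b$, $a\mapsto 1-a$.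
   Context: All algebras are unital $*$-algebras over $\mathbb{C}$ given by generators and relations (the adjoints of the listed relations are also imposed). Fuzzy sphere with real parameter $\lambda$: generators $x_i=x_i^*$ ($i=1,2,3$), relations $[x_i,x_j]=-\imath\lambda\,\epsilon_{ijk}x_k$ (sum over $k$; $\epsilon$ totally antisymmetric, $\epsilon_{123}=1$) and $\sum_i x_i^2=\frac{1-\lambda^2}{4}$. Standard $q$-sphere: generators $a=a^*,b,b^*$, relations $ba=q^2ab$, $bb^*=q^4b^*b+q^2(1-q^2)a$, $b^*b=a(1-a)$. Podleś sphere with real parameters $q^2\ne0$, $s^2$ ($s^2$ is allowed to be negative): generators $x=x^*,z,z^*$, relations $zx=q^2xz$, $zz^*=(s^2+q^2x)(1-q^2x)$, $z^*z=(s^2+x)(1-x)$. It is called nonstandard when $s^2\ne0$. The relations of $S_{q,\lambda}$ say precisely that the matrix $e=\begin{pmatrix}1+\lambda-q^2a& b\\ b^*& a\end{pmatrix}$ satisfies $e^2=e$, where also $e^\dagger=e$ and $\mathrm{trace}_q(e)=1+\lambda$ with $\mathrm{trace}_q\begin{pmatrix}A&B\\ C&D\end{pmatrix}=A+q^2D$. *)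

theory Defs
  imports
    Complex_Main
    "HOL-Library.Poly_Mapping"
    "HOL-Algebra.QuotRing"
    "HOL-Algebra.Module"
begin

text \<open>
  A letter \<open>(g, False)\<close> stands for the generator \<open>g\<close> and \<open>(g, True)\<close> for its adjoint.
  With words as a (non-commutative) additive monoid under concatenation, the convolution product
  of \<open>Poly_Mapping\<close> makes the finitely supported functions from words to \<open>complex\<close> into the free
  unital *-algebra.
\<close>

datatype 'g word = Word (letters: "('g \<times> bool) list")

instantiation word :: (type) monoid_add
begin

definition zero_word :: "'a word" where
  "0 = Word []"

definition plus_word :: "'a word \<Rightarrow> 'a word \<Rightarrow> 'a word" where
  "u + v = Word (letters u @ letters v)"

instance
  by standard (simp_all add: zero_word_def plus_word_def)

end

type_synonym 'g free_salg = "'g word \<Rightarrow>\<^sub>0 complex"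

definition gen :: "'g \<Rightarrow> 'g free_salg" where
  "gen g = Poly_Mapping.single (Word [(g, False)]) 1"

definition scalar :: "complex \<Rightarrow> 'g free_salg" where
  "scalar c = Poly_Mapping.single 0 c"

abbreviation rscalar :: "real \<Rightarrow> 'g free_salg" where
  "rscalar r \<equiv> scalar (complex_of_real r)"

definition word_adj :: "'g word \<Rightarrow> 'g word" where
  "word_adj w = Word (rev (map (\<lambda>(g, s). (g, \<not> s)) (letters w)))"

definition adj :: "'g free_salg \<Rightarrow> 'g free_salg" (\<open>_\<^sup>\<star>\<close> [1000] 999) where
  "f\<^sup>\<star> = (\<Sum>w\<in>Poly_Mapping.keys f.
            Poly_Mapping.single (word_adj w) (cnj (Poly_Mapping.lookup f w)))"

definition free_ring :: "'g free_salg ring" where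
  "free_ring = \<lparr>carrier = UNIV, monoid.mult = (*), one = 1, zero = 0, add = (+)\<rparr>"

record 'a star_algebra = "(complex, 'a) module" +
  star :: "'a \<Rightarrow> 'a"

text \<open>A set of relations is a set of pairs \<open>(l, r)\<close>, read as the equations \<open>l = r\<close>.\<close>

type_synonym 'g relations = "('g free_salg \<times> 'g free_salg) set"

text \<open>The two-sided ideal generated by the relations and their adjoints.\<close>

definition rel_ideal :: "'g relations \<Rightarrow> 'g free_salg set" where
  "rel_ideal R = Idl\<^bsub>free_ring\<^esub> ({l - r | l r. (l, r) \<in> R} \<union> {(l - r)\<^sup>\<star> | l r. (l, r) \<in> R})"

definition cls :: "'g relations \<Rightarrow> 'g free_salg \<Rightarrow> 'g free_salg set" where
  "cls R f = rel_ideal R +>\<^bsub>free_ring\<^esub> f"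

text \<open>
  The ring structure is that of \<open>free_ring Quot rel_ideal R\<close>.  Scalar multiplication and star are
  the ones induced on classes, in the form that \<open>FactRing\<close> uses for its product: the union of the
  classes obtained from all representatives, all of which coincide.
\<close>

definition presented :: "'g relations \<Rightarrow> 'g free_salg set star_algebra" where
  "presented R =
     (let Q = free_ring Quot rel_ideal R in
      \<lparr>carrier = carrier Q, monoid.mult = monoid.mult Q, one = one Q,
       zero = zero Q, add = add Q,
       smult = (\<lambda>c X. \<Union>f\<in>X. cls R (scalar c * f)),
       star = (\<lambda>X. \<Union>f\<in>X. cls R (f\<^sup>\<star>))\<rparr>)"

definition star_alg_iso :: "'a star_algebra \<Rightarrow> 'b star_algebra \<Rightarrow> ('a \<Rightarrow> 'b) set" where
  "star_alg_iso A B =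
     {h \<in> ring_iso A B.
        (\<forall>c. \<forall>x\<in>carrier A. h (c \<odot>\<^bsub>A\<^esub> x) = c \<odot>\<^bsub>B\<^esub> h x) \<and>
        (\<forall>x\<in>carrier A. h (star A x) = star B (h x))}"

definition star_alg_isomorphic :: "'a star_algebra \<Rightarrow> 'b star_algebra \<Rightarrow> bool" (infix \<open>\<cong>\<^sub>\<star>\<close> 50) where
  "A \<cong>\<^sub>\<star> B \<longleftrightarrow> star_alg_iso A B \<noteq> {}"

text \<open>Throughout, the real number \<open>q2\<close> plays the role of \<open>q\<^sup>2\<close> and \<open>s2\<close> that of \<open>s\<^sup>2\<close>.\<close>

datatype sphere_gen = Gen_a | Gen_b

definition qfuzzy_rels :: "real \<Rightarrow> real \<Rightarrow> sphere_gen relations" where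
  "qfuzzy_rels q2 lam =
     (let a = gen Gen_a; b = gen Gen_b in
      {(a, a\<^sup>\<star>),
       (rscalar q2 * a * b - b * a, rscalar lam * b),
       (b * b\<^sup>\<star>, (rscalar q2 * a - rscalar lam) * (1 + rscalar lam - rscalar q2 * a)),
       (b\<^sup>\<star> * b, a * (1 - a))})"

definition qfuzzy_sphere :: "real \<Rightarrow> real \<Rightarrow> sphere_gen free_salg set star_algebra" where
  "qfuzzy_sphere q2 lam = presented (qfuzzy_rels q2 lam)"

definition standard_sphere :: "real \<Rightarrow> sphere_gen free_salg set star_algebra" where
  "standard_sphere q2 =
     (let a = gen Gen_a; b = gen Gen_b in
      presented
       {(a, a\<^sup>\<star>),
        (b * a, rscalar q2 * a * b),
        (b * b\<^sup>\<star>, rscalar (q2\<^sup>2) * b\<^sup>\<star> * b + rscalar (q2 * (1 - q2)) * a),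
        (b\<^sup>\<star> * b, a * (1 - a))})"

datatype podles_gen = Gen_x | Gen_z

definition podles_sphere :: "real \<Rightarrow> real \<Rightarrow> podles_gen free_salg set star_algebra" where
  "podles_sphere q2 s2 =
     (let x = gen Gen_x; z = gen Gen_z in
      presented
       {(x, x\<^sup>\<star>),
        (z * x, rscalar q2 * x * z),
        (z * z\<^sup>\<star>, (rscalar s2 + rscalar q2 * x) * (1 - rscalar q2 * x)),
        (z\<^sup>\<star> * z, (rscalar s2 + x) * (1 - x))})"

datatype fuzzy_gen = X1 | X2 | X3

definition eps :: "fuzzy_gen \<Rightarrow> fuzzy_gen \<Rightarrow> fuzzy_gen \<Rightarrow> complex" where
  "eps i j k =
     (if (i, j, k) \<in> {(X1, X2, X3), (X2, X3, X1), (X3, X1, X2)} then 1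
      else if (i, j, k) \<in> {(X2, X1, X3), (X3, X2, X1), (X1, X3, X2)} then -1
      else 0)"

definition fuzzy_sphere :: "real \<Rightarrow> fuzzy_gen free_salg set star_algebra" where
  "fuzzy_sphere lam =
     presented
      ({(gen i, (gen i)\<^sup>\<star>) | i. True} \<union>
       {(gen i * gen j - gen j * gen i,
         scalar (- (\<i> * complex_of_real lam)) * (\<Sum>k\<in>{X1, X2, X3}. scalar (eps i j k) * gen k))
        | i j. True} \<union>
       {(\<Sum>i\<in>{X1, X2, X3}. gen i * gen i, rscalar ((1 - lam\<^sup>2) / 4))})"

end

theory Submission
  imports Defs
begin

text \<open>
  Each isomorphism is an affine change of generators: \<open>a = c + x\<^sub>3\<close>, \<open>b = x\<^sub>1 - \<i> x\<^sub>2\<close> with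
  \<open>c = (1 + \<lambda>) / 2\<close> for the fuzzy sphere; \<open>a = \<alpha> + (1 - \<alpha>) x\<close>, \<open>b = (1 - \<alpha>) z\<close> with
  \<open>\<alpha> = \<lambda> / (q\<^sup>2 - 1)\<close> for the Podles sphere; \<open>a \<mapsto> 1 - a\<close>, \<open>b \<mapsto> b\<close> for the symmetry
  \<open>\<lambda> \<mapsto> q\<^sup>2 - 1 - \<lambda>\<close>, which also carries \<open>\<lambda> = q\<^sup>2 - 1\<close> to \<open>\<lambda> = 0\<close>, where the presentation is
  equivalent to that of the standard sphere.  A substitution of generators that respects the
  relations in both directions, and is invertible modulo them, induces an isomorphism.
\<close>


section \<open>The free unital *-algebra\<close>

text \<open>A finitely supported function is built by updating one fresh key at a time, and at a
  fresh key the update is the addition of a monomial. Additive identities thus need checking on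
  monomials only.\<close>

lemma free_salg_induct [case_names single add]:
  assumes single: "\<And>w c. P (Poly_Mapping.single w c)"
    and add: "\<And>p q. P p \<Longrightarrow> P q \<Longrightarrow> P (p + q)"
  shows "P (p :: 'g free_salg)"
proof (induction p rule: update_induct)
  case const
  show ?case
    using single[of 0 0] by simp
next
  case (update p w c)
  then have "Poly_Mapping.update w c p = Poly_Mapping.single w c + p"
    by (intro poly_mapping_eqI)
      (auto simp: lookup_update lookup_add lookup_single in_keys_iff)
  then show ?case
    using single[of w c] add update.IH by metis
qed

text \<open>Cancellation can make \<open>keys (p + q)\<close> smaller than the union of the two
  supports, so all three sums are first extended to that union, where the extra terms vanish. This
  gives additivity of both \<open>adj\<close> and \<open>ev\<close>.\<close>

lemma sum_keys_add:
  assumes "\<And>w. k w 0 = 0" and "\<And>w c d. k w (c + d) = k w c + k w d"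
  shows "(\<Sum>w\<in>Poly_Mapping.keys (p + q). k w (Poly_Mapping.lookup (p + q) w)) =
    (\<Sum>w\<in>Poly_Mapping.keys p. k w (Poly_Mapping.lookup p w)) +
    (\<Sum>w\<in>Poly_Mapping.keys q. k w (Poly_Mapping.lookup q w) :: 'b :: comm_monoid_add)"
proof -
  let ?K = "Poly_Mapping.keys p \<union> Poly_Mapping.keys q"
  have *: "(\<Sum>w\<in>Poly_Mapping.keys r. k w (Poly_Mapping.lookup r w)) =
      (\<Sum>w\<in>?K. k w (Poly_Mapping.lookup r w))" if "Poly_Mapping.keys r \<subseteq> ?K" for r
    using that assms(1) by (intro sum.mono_neutral_left) (auto simp: in_keys_iff)
  show ?thesis
    unfolding *[OF keys_add] *[OF Un_upper1] *[OF Un_upper2]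
    by (simp add: lookup_add assms(2) sum.distrib)
qed

section \<open>Scalars as central elements\<close>

lemma scalar_mult_single: "scalar c * Poly_Mapping.single w d = Poly_Mapping.single w (c * d)"
  by (simp add: scalar_def mult_single)

lemma scalar_0 [simp]: "scalar 0 = 0"
  by (simp add: scalar_def)

lemma scalar_1 [simp]: "scalar 1 = 1"
  by (simp add: scalar_def)

lemma scalar_add: "scalar (c + d) = scalar c + scalar d"
  by (simp add: scalar_def single_add)

lemma scalar_uminus: "scalar (- c) = - scalar c"
  by (simp add: scalar_def single_uminus)

lemma scalar_diff: "scalar (c - d) = scalar c - scalar d"
  by (simp add: scalar_def single_diff)

lemma scalar_mult: "scalar (c * d) = scalar c * scalar d"
  by (simp add: scalar_def mult_single)

lemma scalar_central: "p * scalar c = scalar c * p"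
  by (induction p rule: free_salg_induct)
    (simp_all add: scalar_def mult_single mult.commute distrib_left distrib_right)

lemma scalar_left_central: "p * (scalar c * q) = scalar c * (p * q)"
  by (metis mult.assoc scalar_central)

lemma scalar_inverse:
  assumes "c \<noteq> 0"
  shows "scalar c * scalar (inverse c) = 1" "scalar (inverse c) * scalar c = 1"
    "scalar c * (scalar (inverse c) * p) = p" "scalar (inverse c) * (scalar c * p) = p"
  using assms by (simp_all flip: scalar_mult mult.assoc)

lemma scalar_ii [simp]: "scalar \<i> * scalar \<i> = (- 1 :: 'g free_salg)"
  "scalar \<i> * (scalar \<i> * p) = (- p :: 'g free_salg)"
proof -
  show *: "scalar \<i> * scalar \<i> = (- 1 :: 'g free_salg)"
    by (simp add: scalar_uminus flip: scalar_mult)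
  show "scalar \<i> * (scalar \<i> * p) = - p"
    by (simp add: * flip: mult.assoc)
qed

lemma scalar_half_add: "scalar (1/2) * p + scalar (1/2) * p = p"
proof -
  have "scalar (1/2) * p + scalar (1/2) * p = scalar (1/2 + 1/2) * p"
    by (simp only: scalar_add distrib_right)
  then show ?thesis
    by simp
qed

section \<open>The involution\<close>

lemma adj_single [simp]:
  "(Poly_Mapping.single w c)\<^sup>\<star> = Poly_Mapping.single (word_adj w) (cnj c)"
  by (cases "c = 0") (simp_all add: adj_def)

lemma adj_add [simp]: "(p + q)\<^sup>\<star> = p\<^sup>\<star> + q\<^sup>\<star>"
  unfolding adj_def by (intro sum_keys_add) (simp_all add: single_add)

lemma word_adj_add: "word_adj (u + v) = word_adj v + word_adj u"
  by (simp add: word_adj_def plus_word_def)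

lemma word_adj_word_adj [simp]: "word_adj (word_adj w) = w"
  by (cases w) (simp add: word_adj_def rev_map comp_def case_prod_unfold)

lemma adj_mult [simp]: "(p * q)\<^sup>\<star> = q\<^sup>\<star> * p\<^sup>\<star>"
proof (induction p rule: free_salg_induct)
  case (single u c)
  show ?case
    by (induction q rule: free_salg_induct)
      (simp_all add: mult_single word_adj_add mult.commute distrib_left distrib_right)
qed (simp add: distrib_left distrib_right)

lemma adj_adj [simp]: "(p\<^sup>\<star>)\<^sup>\<star> = p"
  by (induction p rule: free_salg_induct) simp_all

lemma adj_scalar [simp]: "(scalar c)\<^sup>\<star> = scalar (cnj c)"
  by (simp add: scalar_def word_adj_def zero_word_def)

lemma adj_0 [simp]: "0\<^sup>\<star> = 0"
  using adj_scalar[of 0] by simp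

lemma adj_1 [simp]: "1\<^sup>\<star> = 1"
  using adj_scalar[of 1] by simp

lemma adj_uminus [simp]: "(- p)\<^sup>\<star> = - p\<^sup>\<star>"
  using adj_add[of p "- p"] by (simp add: add_eq_0_iff)

lemma adj_diff [simp]: "(p - q)\<^sup>\<star> = p\<^sup>\<star> - q\<^sup>\<star>"
  using adj_add[of p "- q"] by simp

lemma adj_gen: "(gen g)\<^sup>\<star> = Poly_Mapping.single (Word [(g, True)]) 1"
  by (simp add: gen_def word_adj_def)

lemma single_Cons:
  "Poly_Mapping.single (Word ((g, s) # l)) 1 =
    (if s then (gen g)\<^sup>\<star> else gen g) * Poly_Mapping.single (Word l) 1"
  by (simp add: adj_gen) (simp add: gen_def mult_single plus_word_def)

text \<open>Every word is a product of generators and their adjoints, so scalars and generators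
  yield everything under star, sum and product. It suits claims about two *-homomorphisms.\<close>

lemma free_salg_gen_induct [case_names scalar gen adj add mult]:
  assumes scalar: "\<And>c. P (scalar c)"
    and gen: "\<And>g. P (gen g)"
    and adj: "\<And>p. P p \<Longrightarrow> P (p\<^sup>\<star>)"
    and add: "\<And>p q. P p \<Longrightarrow> P q \<Longrightarrow> P (p + q)"
    and mult: "\<And>p q. P p \<Longrightarrow> P q \<Longrightarrow> P (p * q)"
  shows "P (p :: 'g free_salg)"
proof (induction p rule: free_salg_induct)
  case (single w c)
  have "P (Poly_Mapping.single (Word l) 1)" for l
  proof (induction l)
    case Nil
    show ?case
      using scalar[of 1] by (simp add: scalar_def zero_word_def)
  next
    case (Cons x l)
    then show ?case
      by (cases x) (auto simp: single_Cons intro!: mult gen adj)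
  qed
  then have "P (scalar c * Poly_Mapping.single w 1)"
    by (metis mult scalar word.collapse)
  then show ?case
    by (simp add: scalar_mult_single)
qed (fact add)

lemmas scalar_expand = scalar_add scalar_diff scalar_uminus scalar_mult

text \<open>These rules move scalars to the front of each monomial. Instances are restricted to
  atomic left factors because the general rule would loop on a product of two scalars; with
  \<open>scalar c\<close> on the left it is permutative and merely sorts them.\<close>

lemmas scalar_left =
  scalar_central[of "gen g" for g] scalar_left_central[of "gen g" for g]
  scalar_central[of "(gen g)\<^sup>\<star>" for g] scalar_left_central[of "(gen g)\<^sup>\<star>" for g]
  scalar_central[of "scalar c" for c] scalar_left_central[of "scalar c" for c]

lemmas salg_simps = algebra_simps scalar_expand scalar_left


section \<open>Evaluation homomorphisms\<close>

definition ev_word :: "('g \<Rightarrow> 'h free_salg) \<Rightarrow> 'g word \<Rightarrow> 'h free_salg" where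
  "ev_word f w = prod_list (map (\<lambda>(g, s). if s then (f g)\<^sup>\<star> else f g) (letters w))"

text \<open>The map given by the universal property of the free unital *-algebra: substitution of
  \<open>f g\<close> for \<open>g\<close>, extended as a *-homomorphism.\<close>

definition ev :: "('g \<Rightarrow> 'h free_salg) \<Rightarrow> 'g free_salg \<Rightarrow> 'h free_salg" where
  "ev f p = (\<Sum>w\<in>Poly_Mapping.keys p. scalar (Poly_Mapping.lookup p w) * ev_word f w)"

lemma ev_single: "ev f (Poly_Mapping.single w c) = scalar c * ev_word f w"
  by (cases "c = 0") (simp_all add: ev_def)

lemma ev_add [simp]: "ev f (p + q) = ev f p + ev f q"
  unfolding ev_def by (intro sum_keys_add) (simp_all add: scalar_add distrib_right)

lemma ev_word_add: "ev_word f (u + v) = ev_word f u * ev_word f v"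
  by (simp add: ev_word_def plus_word_def)

lemma ev_scalar [simp]: "ev f (scalar c) = scalar c"
  using ev_single[of f 0 c] by (simp add: scalar_def ev_word_def zero_word_def)

lemma ev_gen [simp]: "ev f (gen g) = f g"
  by (simp add: gen_def ev_single ev_word_def)

lemma ev_mult [simp]: "ev f (p * q) = ev f p * ev f q"
proof (induction p rule: free_salg_induct)
  case (single u c)
  show ?case
    by (induction q rule: free_salg_induct)
      (simp_all add: mult_single ev_single ev_word_add scalar_mult scalar_left_central[of "ev_word f u"]
        distrib_left distrib_right mult.assoc)
qed (simp add: distrib_right)

lemma ev_adj [simp]: "ev f (p\<^sup>\<star>) = (ev f p)\<^sup>\<star>"
proof (induction p rule: free_salg_gen_induct)
  case (gen g)
  show ?case
    by (simp add: adj_gen ev_single ev_word_def)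
qed simp_all

lemma ev_0 [simp]: "ev f 0 = 0"
  using ev_scalar[of f 0] by simp

lemma ev_1 [simp]: "ev f 1 = 1"
  using ev_scalar[of f 1] by simp

lemma ev_uminus [simp]: "ev f (- p) = - ev f p"
  using ev_add[of f p "- p"] by (simp add: add_eq_0_iff)

lemma ev_diff [simp]: "ev f (p - q) = ev f p - ev f q"
  using ev_add[of f p "- q"] by simp

lemma ev_gen_id [simp]: "ev gen p = p"
  by (induction p rule: free_salg_gen_induct) simp_all


section \<open>Congruence modulo the relations\<close>

lemma free_ring_simps [simp]:
  "carrier free_ring = UNIV" "p \<otimes>\<^bsub>free_ring\<^esub> q = p * q" "\<one>\<^bsub>free_ring\<^esub> = 1"
  "p \<oplus>\<^bsub>free_ring\<^esub> q = p + q" "\<zero>\<^bsub>free_ring\<^esub> = 0"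
  by (simp_all add: free_ring_def)

lemma ring_free_ring: "ring (free_ring :: 'g free_salg ring)"
proof (intro ringI abelian_groupI monoidI)
  show "\<exists>y\<in>carrier free_ring. y \<oplus>\<^bsub>free_ring\<^esub> x = \<zero>\<^bsub>free_ring\<^esub>" for x :: "'g free_salg"
    by (rule bexI[of _ "- x"]) simp_all
qed (simp_all add: add.assoc add.commute mult.assoc distrib_left distrib_right)

lemma ideal_rel_ideal: "ideal (rel_ideal R) free_ring"
  unfolding rel_ideal_def by (intro ring.genideal_ideal ring_free_ring) simp

lemma free_ring_a_inv [simp]: "\<ominus>\<^bsub>free_ring\<^esub> p = - p"
  using abelian_group.minus_equality[OF ring.is_abelian_group[OF ring_free_ring], of "- p" p]
  by simp

text \<open>Equality in the quotient, expressed on representatives so that all computations stay in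
  the free algebra.\<close>

definition rel_eq :: "'g relations \<Rightarrow> 'g free_salg \<Rightarrow> 'g free_salg \<Rightarrow> bool" where
  "rel_eq R p q \<longleftrightarrow> p - q \<in> rel_ideal R"

lemma rel_ideal_add: "p \<in> rel_ideal R \<Longrightarrow> q \<in> rel_ideal R \<Longrightarrow> p + q \<in> rel_ideal R"
  using additive_subgroup.a_closed[OF ideal.axioms(1)[OF ideal_rel_ideal]] by fastforce

lemma rel_ideal_mult_left: "p \<in> rel_ideal R \<Longrightarrow> q * p \<in> rel_ideal R"
  using ideal.I_l_closed[OF ideal_rel_ideal] by fastforce

lemma rel_ideal_mult_right: "p \<in> rel_ideal R \<Longrightarrow> p * q \<in> rel_ideal R"
  using ideal.I_r_closed[OF ideal_rel_ideal] by fastforce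

lemma rel_ideal_uminus: "p \<in> rel_ideal R \<Longrightarrow> - p \<in> rel_ideal R"
  using rel_ideal_mult_left[of p R "- 1"] by simp

lemma rel_ideal_0: "0 \<in> rel_ideal R"
  using additive_subgroup.zero_closed[OF ideal.axioms(1)[OF ideal_rel_ideal[of R]]] by simp

text \<open>The closure conditions make \<open>{p. P p}\<close> a two-sided ideal containing the
  generating set, so minimality of the generated ideal applies. Negation is multiplication by
  \<open>- 1\<close>.\<close>

lemma rel_ideal_induct [consumes 1, case_names zero rel rel_adj add mult_left mult_right]:
  assumes "p \<in> rel_ideal R"
    and zero: "P 0"
    and rel: "\<And>l r. (l, r) \<in> R \<Longrightarrow> P (l - r)"
    and rel_adj: "\<And>l r. (l, r) \<in> R \<Longrightarrow> P ((l - r)\<^sup>\<star>)"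
    and add: "\<And>p q. P p \<Longrightarrow> P q \<Longrightarrow> P (p + q)"
    and mult_left: "\<And>p q. P p \<Longrightarrow> P (q * p)"
    and mult_right: "\<And>p q. P p \<Longrightarrow> P (p * q)"
  shows "P p"
proof -
  interpret ring "free_ring :: 'a free_salg ring"
    by (fact ring_free_ring)
  have uminus: "P (- p)" if "P p" for p
    using mult_left[OF that, of "- 1"] by simp
  have "ideal {p. P p} free_ring"
  proof (intro idealI ring_free_ring add.subgroupI)
    show "{p. P p} \<noteq> {}"
      using zero by auto
  qed (auto intro: add mult_left mult_right uminus simp: a_inv_def[symmetric])
  then have "rel_ideal R \<subseteq> {p. P p}"
    unfolding rel_ideal_def by (intro genideal_minimal) (auto intro: rel rel_adj simp del: adj_diff)
  then show ?thesis
    using assms(1) by auto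
qed

lemma rel_ideal_rel:
  assumes "(l, r) \<in> R"
  shows "l - r \<in> rel_ideal R" "(l - r)\<^sup>\<star> \<in> rel_ideal R"
proof -
  let ?S = "{l - r | l r. (l, r) \<in> R} \<union> {(l - r)\<^sup>\<star> | l r. (l, r) \<in> R}"
  have "?S \<subseteq> rel_ideal R"
    unfolding rel_ideal_def by (rule ring.genideal_self[OF ring_free_ring]) simp
  then show "l - r \<in> rel_ideal R" "(l - r)\<^sup>\<star> \<in> rel_ideal R"
    using assms by blast+
qed

text \<open>The generating set contains the adjoint of each relation and star is an involution, so
  star permutes the generators of the ideal; on multiples it exchanges left and right.\<close>

lemma rel_ideal_adj: "p \<in> rel_ideal R \<Longrightarrow> p\<^sup>\<star> \<in> rel_ideal R"
proof (induction p rule: rel_ideal_induct)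
  case (rel l r)
  then show ?case
    by (rule rel_ideal_rel)
next
  case (rel_adj l r)
  then show ?case
    unfolding adj_adj by (rule rel_ideal_rel)
qed (auto intro: rel_ideal_0 rel_ideal_add rel_ideal_mult_left rel_ideal_mult_right)

lemma rel_eq_rel: "(l, r) \<in> R \<Longrightarrow> rel_eq R l r"
  by (simp add: rel_eq_def rel_ideal_rel)

lemma rel_eq_refl [simp]: "rel_eq R p p"
  by (simp add: rel_eq_def rel_ideal_0)

lemma rel_eq_sym: "rel_eq R p q \<Longrightarrow> rel_eq R q p"
  unfolding rel_eq_def using rel_ideal_uminus[of "p - q"] by simp

lemma rel_eq_trans [trans]: "rel_eq R p q \<Longrightarrow> rel_eq R q r \<Longrightarrow> rel_eq R p r"
  unfolding rel_eq_def using rel_ideal_add[of "p - q" R "q - r"] by simp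

lemma rel_eq_add: "rel_eq R p q \<Longrightarrow> rel_eq R p' q' \<Longrightarrow> rel_eq R (p + p') (q + q')"
  unfolding rel_eq_def using rel_ideal_add[of "p - q" R "p' - q'"] by (simp add: algebra_simps)

lemma rel_eq_uminus: "rel_eq R p q \<Longrightarrow> rel_eq R (- p) (- q)"
  unfolding rel_eq_def using rel_ideal_uminus[of "p - q"] by simp

lemma rel_eq_diff: "rel_eq R p q \<Longrightarrow> rel_eq R p' q' \<Longrightarrow> rel_eq R (p - p') (q - q')"
  using rel_eq_add[of R p q "- p'" "- q'"] rel_eq_uminus by fastforce

lemma rel_eq_mult: "rel_eq R p q \<Longrightarrow> rel_eq R p' q' \<Longrightarrow> rel_eq R (p * p') (q * q')"
  unfolding rel_eq_def
  using rel_ideal_add[OF rel_ideal_mult_right[of "p - q" R p'] rel_ideal_mult_left[of "p' - q'" R q]]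
  by (simp add: algebra_simps)

lemma rel_eq_adj: "rel_eq R p q \<Longrightarrow> rel_eq R (p\<^sup>\<star>) (q\<^sup>\<star>)"
  unfolding rel_eq_def using rel_ideal_adj[of "p - q"] by simp

lemma rel_eq_scale: "rel_eq R p q \<Longrightarrow> rel_eq R (scalar c * p) (scalar c * q)"
  by (intro rel_eq_mult rel_eq_refl)

text \<open>Only the listed relations have to be respected: the adjoint ones follow, since
  \<open>ev f\<close> commutes with star and the target ideal is closed under star.\<close>

lemma ev_rel_ideal:
  assumes "p \<in> rel_ideal R" and "\<And>l r. (l, r) \<in> R \<Longrightarrow> rel_eq R' (ev f l) (ev f r)"
  shows "ev f p \<in> rel_ideal R'"
  using assms(1)
proof (induction p rule: rel_ideal_induct)
  case (rel l r)
  then show ?case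
    using assms(2)[of l r] by (simp add: rel_eq_def)
next
  case (rel_adj l r)
  then show ?case
    using rel_ideal_adj[of "ev f (l - r)" R'] assms(2)[of l r] by (simp add: rel_eq_def)
qed (auto intro: rel_ideal_0 rel_ideal_add rel_ideal_mult_left rel_ideal_mult_right)

lemma rel_eq_ev:
  assumes "rel_eq R p q" and "\<And>l r. (l, r) \<in> R \<Longrightarrow> rel_eq R' (ev f l) (ev f r)"
  shows "rel_eq R' (ev f p) (ev f q)"
  using ev_rel_ideal[of "p - q" R R' f] assms by (simp add: rel_eq_def)

lemma rel_eq_ev_ev:
  assumes "\<And>x. rel_eq R (ev g (f x)) (gen x)"
  shows "rel_eq R (ev g (ev f p)) p"
  by (induction p rule: free_salg_gen_induct)
    (simp_all add: assms rel_eq_add rel_eq_mult rel_eq_adj)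


section \<open>Isomorphisms of presented *-algebras\<close>

lemma mem_cls_iff: "p \<in> cls R q \<longleftrightarrow> rel_eq R p q"
proof -
  interpret ideal "rel_ideal R" free_ring
    by (fact ideal_rel_ideal)
  show ?thesis
    using a_rcos_module[of q p] by (simp add: cls_def rel_eq_def)
qed

lemma cls_eq_iff: "cls R p = cls R q \<longleftrightarrow> rel_eq R p q"
  by (auto simp: mem_cls_iff set_eq_iff intro: rel_eq_trans rel_eq_sym dest: spec[of _ p])

text \<open>Evaluates the union form in which scalar multiplication and star of
  \<open>presented\<close> are defined: when \<open>F\<close> respects the congruence, all classes
  in the union coincide.\<close>

lemma UN_cls:
  assumes "\<And>q. rel_eq R q p \<Longrightarrow> rel_eq R' (F q) (F p)"
  shows "(\<Union>q\<in>cls R p. cls R' (F q)) = cls R' (F p)"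
proof -
  have "cls R' (F q) = cls R' (F p)" if "q \<in> cls R p" for q
    using that assms by (simp add: mem_cls_iff cls_eq_iff)
  moreover have "p \<in> cls R p"
    by (simp add: mem_cls_iff)
  ultimately show ?thesis
    by blast
qed

lemma carrier_presented: "carrier (presented R) = range (cls R)"
  by (auto simp: presented_def Let_def FactRing_def A_RCOSETS_def' cls_def)

lemma presented_simps:
  "cls R p \<otimes>\<^bsub>presented R\<^esub> cls R q = cls R (p * q)"
  "cls R p \<oplus>\<^bsub>presented R\<^esub> cls R q = cls R (p + q)"
  "\<one>\<^bsub>presented R\<^esub> = cls R 1"
  "c \<odot>\<^bsub>presented R\<^esub> cls R p = cls R (scalar c * p)"
  "star (presented R) (cls R p) = cls R (p\<^sup>\<star>)"
proof -
  interpret ideal "rel_ideal R" free_ring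
    by (fact ideal_rel_ideal)
  show "cls R p \<otimes>\<^bsub>presented R\<^esub> cls R q = cls R (p * q)"
    using rcoset_mult_add[of p q] by (simp add: presented_def Let_def FactRing_def cls_def)
  show "cls R p \<oplus>\<^bsub>presented R\<^esub> cls R q = cls R (p + q)"
    using a_rcos_sum[of p q] by (simp add: presented_def Let_def FactRing_def cls_def)
  show "\<one>\<^bsub>presented R\<^esub> = cls R 1"
    by (simp add: presented_def Let_def FactRing_def cls_def)
  show "c \<odot>\<^bsub>presented R\<^esub> cls R p = cls R (scalar c * p)"
    by (simp add: presented_def Let_def UN_cls rel_eq_mult)
  show "star (presented R) (cls R p) = cls R (p\<^sup>\<star>)"
    by (simp add: presented_def Let_def UN_cls rel_eq_adj)
qed

text \<open>Respecting the relations makes both substitutions descend to the quotients, where the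
  last two assumptions make them mutually inverse. The action on classes is kept in the conclusion
  because the symmetry claim prescribes the images of the generators.\<close>

lemma presented_iso:
  assumes f: "\<And>l r. (l, r) \<in> R \<Longrightarrow> rel_eq R' (ev f l) (ev f r)"
    and g: "\<And>l r. (l, r) \<in> R' \<Longrightarrow> rel_eq R (ev g l) (ev g r)"
    and gf: "\<And>x. rel_eq R (ev g (f x)) (gen x)"
    and fg: "\<And>y. rel_eq R' (ev f (g y)) (gen y)"
  shows "\<exists>h\<in>star_alg_iso (presented R) (presented R'). \<forall>p. h (cls R p) = cls R' (ev f p)"
proof -
  define h where "h = (\<lambda>X. \<Union>p\<in>X. cls R' (ev f p))"
  have h: "h (cls R p) = cls R' (ev f p)" for p
    unfolding h_def by (intro UN_cls rel_eq_ev[OF _ f])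
  \<comment> \<open>Injectivity: applying \<open>ev g\<close> to the congruence brings it back to
    \<open>R\<close>, where \<open>ev g (ev f p)\<close> is congruent to \<open>p\<close>.\<close>
  have "rel_eq R p q" if "rel_eq R' (ev f p) (ev f q)" for p q
    using rel_eq_ev[OF that g] rel_eq_ev_ev[OF gf] by (meson rel_eq_sym rel_eq_trans)
  then have "inj_on h (carrier (presented R))"
    by (auto simp: inj_on_def carrier_presented h cls_eq_iff)
  moreover have "cls R' p = h (cls R (ev g p))" for p
    using rel_eq_ev_ev[OF fg] by (simp add: h cls_eq_iff rel_eq_sym)
  then have "h ` carrier (presented R) = carrier (presented R')"
    by (force simp: carrier_presented h)
  moreover have "h \<in> ring_hom (presented R) (presented R')"
    by (rule ring_hom_memI) (auto simp: carrier_presented presented_simps h)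
  ultimately have "h \<in> star_alg_iso (presented R) (presented R')"
    by (auto simp: star_alg_iso_def ring_iso_def bij_betw_def carrier_presented presented_simps h)
  then show ?thesis
    using h by blast
qed

lemma presented_isomorphic:
  assumes "\<And>l r. (l, r) \<in> R \<Longrightarrow> rel_eq R' (ev f l) (ev f r)"
    and "\<And>l r. (l, r) \<in> R' \<Longrightarrow> rel_eq R (ev g l) (ev g r)"
    and "\<And>x. rel_eq R (ev g (f x)) (gen x)"
    and "\<And>y. rel_eq R' (ev f (g y)) (gen y)"
  shows "presented R \<cong>\<^sub>\<star> presented R'"
  using presented_iso[of R R' f g] assms unfolding star_alg_isomorphic_def by blast

lemma star_alg_isomorphic_trans:
  assumes "A \<cong>\<^sub>\<star> B" and "B \<cong>\<^sub>\<star> C"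
  shows "A \<cong>\<^sub>\<star> C"
proof -
  obtain h k where "h \<in> star_alg_iso A B" and "k \<in> star_alg_iso B C"
    using assms by (auto simp: star_alg_isomorphic_def)
  then have "k \<circ> h \<in> star_alg_iso A C"
    using ring_iso_set_trans[of h A B k C] ring_iso_memE(1)[of h A B]
    by (auto simp: star_alg_iso_def)
  then show ?thesis
    by (auto simp: star_alg_isomorphic_def)
qed


section \<open>The \<open>q\<close>-fuzzy sphere\<close>

lemma qfuzzy_rel_eqs:
  fixes q2 lam
  defines "R \<equiv> qfuzzy_rels q2 lam"
  shows "rel_eq R (gen Gen_a) ((gen Gen_a)\<^sup>\<star>)"
    and "rel_eq R (rscalar q2 * gen Gen_a * gen Gen_b - gen Gen_b * gen Gen_a) (rscalar lam * gen Gen_b)"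
    and "rel_eq R (gen Gen_b * (gen Gen_b)\<^sup>\<star>)
      ((rscalar q2 * gen Gen_a - rscalar lam) * (1 + rscalar lam - rscalar q2 * gen Gen_a))"
    and "rel_eq R ((gen Gen_b)\<^sup>\<star> * gen Gen_b) (gen Gen_a * (1 - gen Gen_a))"
  by (rule rel_eq_rel; simp add: R_def qfuzzy_rels_def Let_def)+

lemma rel_eq_ev_qfuzzy:
  assumes "(l, r) \<in> qfuzzy_rels q2 lam"
    and "rel_eq R (f Gen_a) ((f Gen_a)\<^sup>\<star>)"
    and "rel_eq R (rscalar q2 * f Gen_a * f Gen_b - f Gen_b * f Gen_a) (rscalar lam * f Gen_b)"
    and "rel_eq R (f Gen_b * (f Gen_b)\<^sup>\<star>)
      ((rscalar q2 * f Gen_a - rscalar lam) * (1 + rscalar lam - rscalar q2 * f Gen_a))"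
    and "rel_eq R ((f Gen_b)\<^sup>\<star> * f Gen_b) (f Gen_a * (1 - f Gen_a))"
  shows "rel_eq R (ev f l) (ev f r)"
  using assms unfolding qfuzzy_rels_def Let_def by auto

definition sphere_flip :: "sphere_gen \<Rightarrow> sphere_gen free_salg" where
  "sphere_flip x = (case x of Gen_a \<Rightarrow> 1 - gen Gen_a | Gen_b \<Rightarrow> gen Gen_b)"

lemma sphere_flip_simps [simp]:
  "sphere_flip Gen_a = 1 - gen Gen_a" "sphere_flip Gen_b = gen Gen_b"
  by (simp_all add: sphere_flip_def)

lemma sphere_flip_flip: "ev sphere_flip (sphere_flip x) = gen x"
  by (cases x) simp_all

text \<open>With \<open>mu = q2 - 1 - lam\<close>, replacing \<open>a\<close> by
  \<open>1 - a\<close> turns \<open>q2 a - lam\<close> into \<open>1 + mu - q2 a\<close> and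
  \<open>1 + lam - q2 a\<close> into \<open>q2 a - mu\<close>. The two factors are exchanged, and
  they commute; likewise \<open>a\<close> and \<open>1 - a\<close>.\<close>

lemma qfuzzy_flip:
  assumes "(l, r) \<in> qfuzzy_rels q2 lam"
  shows "rel_eq (qfuzzy_rels q2 (q2 - 1 - lam)) (ev sphere_flip l) (ev sphere_flip r)"
proof -
  note Q = qfuzzy_rel_eqs[of q2 "q2 - 1 - lam"]
  let ?a = "gen Gen_a" and ?b = "gen Gen_b" and ?Q = "qfuzzy_rels q2 (q2 - 1 - lam)"
  show ?thesis
    using assms
  proof (rule rel_eq_ev_qfuzzy; unfold sphere_flip_simps)
    show "rel_eq ?Q (1 - ?a) ((1 - ?a)\<^sup>\<star>)"
      using Q(1) by (simp add: rel_eq_diff)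
    \<comment> \<open>The constant term of \<open>1 - a\<close> contributes
      \<open>(q2 - 1) b\<close>, and \<open>(q2 - 1) - (q2 - 1 - lam) = lam\<close>.\<close>
    have "rel_eq ?Q ((rscalar q2 - 1) * ?b - (rscalar q2 * ?a * ?b - ?b * ?a))
        ((rscalar q2 - 1) * ?b - rscalar (q2 - 1 - lam) * ?b)"
      by (intro rel_eq_diff rel_eq_refl Q)
    then show "rel_eq ?Q (rscalar q2 * (1 - ?a) * ?b - ?b * (1 - ?a)) (rscalar lam * ?b)"
      by (simp add: salg_simps)
    show "rel_eq ?Q (?b * ?b\<^sup>\<star>)
        ((rscalar q2 * (1 - ?a) - rscalar lam) * (1 + rscalar lam - rscalar q2 * (1 - ?a)))"
      using Q(3) by (simp add: salg_simps)
    show "rel_eq ?Q (?b\<^sup>\<star> * ?b) ((1 - ?a) * (1 - (1 - ?a)))"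
      using Q(4) by (simp add: salg_simps)
  qed
qed

lemma qfuzzy_flip_iso:
  "\<exists>h\<in>star_alg_iso (qfuzzy_sphere q2 lam) (qfuzzy_sphere q2 (q2 - 1 - lam)).
    \<forall>p. h (cls (qfuzzy_rels q2 lam) p) = cls (qfuzzy_rels q2 (q2 - 1 - lam)) (ev sphere_flip p)"
  unfolding qfuzzy_sphere_def
proof (rule presented_iso[of _ _ _ sphere_flip])
  show "rel_eq (qfuzzy_rels q2 lam) (ev sphere_flip l) (ev sphere_flip r)"
    if "(l, r) \<in> qfuzzy_rels q2 (q2 - 1 - lam)" for l r
    \<comment> \<open>The parameter change is an involution, so the same lemma serves the inverse
      direction.\<close>
    using qfuzzy_flip[OF that] by simp
qed (simp_all add: qfuzzy_flip sphere_flip_flip)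


section \<open>The standard sphere\<close>

text \<open>The relation set inside \<open>standard_sphere\<close>, named so that congruences can
  refer to it.\<close>

definition standard_rels :: "real \<Rightarrow> sphere_gen relations" where
  "standard_rels q2 =
     (let a = gen Gen_a; b = gen Gen_b in
       {(a, a\<^sup>\<star>),
        (b * a, rscalar q2 * a * b),
        (b * b\<^sup>\<star>, rscalar (q2\<^sup>2) * b\<^sup>\<star> * b + rscalar (q2 * (1 - q2)) * a),
        (b\<^sup>\<star> * b, a * (1 - a))})"

text \<open>The generators stay the same. The two forms of the relation for \<open>b * adj b\<close>
  are interchangeable modulo \<open>adj b * b = a (1 - a)\<close>, by the identity labelled
  \<open>*\<close>.\<close>

lemma qfuzzy_0_standard: "qfuzzy_sphere q2 0 \<cong>\<^sub>\<star> standard_sphere q2"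
proof -
  let ?a = "gen Gen_a" and ?b = "gen Gen_b" and ?Q = "qfuzzy_rels q2 0" and ?S = "standard_rels q2"
  note Q = qfuzzy_rel_eqs[of q2 0]
  have S: "rel_eq ?S ?a (?a\<^sup>\<star>)" "rel_eq ?S (?b * ?a) (rscalar q2 * ?a * ?b)"
    "rel_eq ?S (?b * ?b\<^sup>\<star>) (rscalar (q2\<^sup>2) * (?b\<^sup>\<star> * ?b) + rscalar (q2 * (1 - q2)) * ?a)"
    "rel_eq ?S (?b\<^sup>\<star> * ?b) (?a * (1 - ?a))"
    by (rule rel_eq_rel; simp add: standard_rels_def Let_def mult.assoc)+
  have *: "rscalar (q2\<^sup>2) * (?a * (1 - ?a)) + rscalar (q2 * (1 - q2)) * ?a =
      (rscalar q2 * ?a) * (1 - rscalar q2 * ?a)"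
    by (simp add: salg_simps power2_eq_square)
  have "rel_eq ?S (rscalar q2 * ?a * ?b - ?b * ?a) 0"
    using rel_eq_diff[OF rel_eq_refl S(2), of "rscalar q2 * ?a * ?b"] by simp
  moreover have "rel_eq ?S (?b * ?b\<^sup>\<star>) ((rscalar q2 * ?a) * (1 - rscalar q2 * ?a))"
    unfolding *[symmetric]
    by (rule rel_eq_trans[OF S(3)]) (intro rel_eq_add rel_eq_scale S rel_eq_refl)
  ultimately have 1: "rel_eq ?S l r" if "(l, r) \<in> ?Q" for l r
    using that S by (auto simp: qfuzzy_rels_def Let_def)
  have "rel_eq ?Q (?b * ?a) (rscalar q2 * ?a * ?b)"
    using rel_eq_diff[OF rel_eq_refl Q(2), of "rscalar q2 * ?a * ?b"] by simp
  moreover have "rel_eq ?Q (?b * ?b\<^sup>\<star>)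
      (rscalar (q2\<^sup>2) * (?b\<^sup>\<star> * ?b) + rscalar (q2 * (1 - q2)) * ?a)"
  proof (rule rel_eq_trans)
    show "rel_eq ?Q (?b * ?b\<^sup>\<star>) (rscalar (q2\<^sup>2) * (?a * (1 - ?a)) + rscalar (q2 * (1 - q2)) * ?a)"
      unfolding * using Q(3) by simp
  qed (intro rel_eq_add rel_eq_scale rel_eq_sym[OF Q(4)] rel_eq_refl)
  ultimately have 2: "rel_eq ?Q l r" if "(l, r) \<in> ?S" for l r
    using that Q by (auto simp: standard_rels_def Let_def mult.assoc)
  have "standard_sphere q2 = presented ?S"
    by (simp add: standard_sphere_def standard_rels_def Let_def)
  then show ?thesis
    unfolding qfuzzy_sphere_def
    using presented_isomorphic[of ?Q ?S gen gen] 1 2 by simp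
qed


section \<open>The Podles sphere\<close>

definition podles_rels :: "real \<Rightarrow> real \<Rightarrow> podles_gen relations" where
  "podles_rels q2 s2 =
     (let x = gen Gen_x; z = gen Gen_z in
       {(x, x\<^sup>\<star>),
        (z * x, rscalar q2 * x * z),
        (z * z\<^sup>\<star>, (rscalar s2 + rscalar q2 * x) * (1 - rscalar q2 * x)),
        (z\<^sup>\<star> * z, (rscalar s2 + x) * (1 - x))})"

lemma podles_rel_eqs:
  fixes q2 s2
  defines "R \<equiv> podles_rels q2 s2"
  shows "rel_eq R (gen Gen_x) ((gen Gen_x)\<^sup>\<star>)"
    and "rel_eq R (gen Gen_z * gen Gen_x) (rscalar q2 * gen Gen_x * gen Gen_z)"
    and "rel_eq R (gen Gen_z * (gen Gen_z)\<^sup>\<star>)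
      ((rscalar s2 + rscalar q2 * gen Gen_x) * (1 - rscalar q2 * gen Gen_x))"
    and "rel_eq R ((gen Gen_z)\<^sup>\<star> * gen Gen_z) ((rscalar s2 + gen Gen_x) * (1 - gen Gen_x))"
  by (rule rel_eq_rel; simp add: R_def podles_rels_def Let_def)+

lemma rel_eq_ev_podles:
  assumes "(l, r) \<in> podles_rels q2 s2"
    and "rel_eq R (f Gen_x) ((f Gen_x)\<^sup>\<star>)"
    and "rel_eq R (f Gen_z * f Gen_x) (rscalar q2 * f Gen_x * f Gen_z)"
    and "rel_eq R (f Gen_z * (f Gen_z)\<^sup>\<star>)
      ((rscalar s2 + rscalar q2 * f Gen_x) * (1 - rscalar q2 * f Gen_x))"
    and "rel_eq R ((f Gen_z)\<^sup>\<star> * f Gen_z) ((rscalar s2 + f Gen_x) * (1 - f Gen_x))"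
  shows "rel_eq R (ev f l) (ev f r)"
  using assms unfolding podles_rels_def Let_def by auto

text \<open>The parameters are solved for in terms of the value \<open>\<alpha>\<close> of \<open>a\<close> at \<open>x = 0\<close>:
  \<open>\<lambda> = (q\<^sup>2 - 1) \<alpha>\<close> and \<open>s\<^sup>2 = \<alpha> / (1 - \<alpha>)\<close>.\<close>

lemma qfuzzy_podles:
  fixes q2 \<alpha> s2 :: real
  assumes "\<alpha> \<noteq> 1"
  defines "s2 \<equiv> \<alpha> / (1 - \<alpha>)"
  shows "qfuzzy_sphere q2 ((q2 - 1) * \<alpha>) \<cong>\<^sub>\<star> podles_sphere q2 s2"
proof -
  let ?a = "gen Gen_a" and ?b = "gen Gen_b" and ?x = "gen Gen_x" and ?z = "gen Gen_z"
  let ?Q = "qfuzzy_rels q2 ((q2 - 1) * \<alpha>)" and ?P = "podles_rels q2 s2"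
  let ?q = "rscalar q2" and ?\<alpha> = "rscalar \<alpha>"
  \<comment> \<open>The slope of the affine map that sends \<open>x = 0\<close> to
    \<open>a = \<alpha>\<close> and \<open>x = 1\<close> to \<open>a = 1\<close>.\<close>
  define \<beta> where "\<beta> = 1 - \<alpha>"
  define f where "f y = (case y of Gen_a \<Rightarrow> rscalar \<alpha> + rscalar \<beta> * ?x | Gen_b \<Rightarrow> rscalar \<beta> * ?z)" for y
  define g where "g y = (case y of Gen_x \<Rightarrow> rscalar (inverse \<beta>) * (?a - rscalar \<alpha>)
    | Gen_z \<Rightarrow> rscalar (inverse \<beta>) * ?b)" for y
  have f [simp]: "f Gen_a = rscalar \<alpha> + rscalar \<beta> * ?x" "f Gen_b = rscalar \<beta> * ?z"
    by (simp_all add: f_def)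
  have g [simp]: "g Gen_x = rscalar (inverse \<beta>) * (?a - rscalar \<alpha>)" "g Gen_z = rscalar (inverse \<beta>) * ?b"
    by (simp_all add: g_def)
  have "\<beta> \<noteq> 0"
    using assms by (simp add: \<beta>_def)
  then have "complex_of_real \<beta> \<noteq> 0"
    by simp
  note inv' = scalar_inverse[OF this] and inv = scalar_inverse[OF this, folded of_real_inverse]
  have s: "rscalar \<beta> * rscalar s2 = (?\<alpha> :: podles_gen free_salg)"
    using \<open>\<beta> \<noteq> 0\<close> by (simp add: s2_def \<beta>_def flip: scalar_mult of_real_mult)
  have s': "rscalar s2 = rscalar (inverse \<beta>) * (?\<alpha> :: sphere_gen free_salg)"
    by (simp add: s2_def \<beta>_def field_simps flip: scalar_mult of_real_mult of_real_inverse)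
  have one: "1 - ?\<alpha> = (rscalar \<beta> :: podles_gen free_salg)" "1 - ?\<alpha> = (rscalar \<beta> :: sphere_gen free_salg)"
    by (simp_all add: \<beta>_def scalar_diff)
  note Q = qfuzzy_rel_eqs[of q2 "(q2 - 1) * \<alpha>"] and P = podles_rel_eqs[of q2 s2]
  \<comment> \<open>Since \<open>\<beta> s2 = \<alpha>\<close> and
    \<open>1 - \<alpha> = \<beta>\<close>, the product \<open>a (1 - a)\<close> becomes
    \<open>\<beta>^2 (s2 + p) (1 - p)\<close> at \<open>a = \<alpha> + \<beta> p\<close>. Taking
    \<open>p = x\<close> and \<open>p = q2 x\<close> covers both quadratic relations.\<close>
  have scale: "rscalar \<beta> * (rscalar \<beta> * ((rscalar s2 + p) * (1 - p))) =
      (?\<alpha> + rscalar \<beta> * p) * (1 - (?\<alpha> + rscalar \<beta> * p))" for p :: "podles_gen free_salg"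
  proof -
    have "rscalar \<beta> * (rscalar \<beta> * ((rscalar s2 + p) * (1 - p))) =
        (rscalar \<beta> * (rscalar s2 + p)) * (rscalar \<beta> * (1 - p))"
      by (simp only: mult.assoc scalar_left_central[of "rscalar s2 + p"])
    moreover have "1 - (?\<alpha> + rscalar \<beta> * p) = rscalar \<beta> * (1 - p)"
      by (simp add: diff_diff_eq[symmetric] one right_diff_distrib)
    ultimately show ?thesis
      by (simp add: s distrib_left)
  qed
  have scale': "rscalar (inverse \<beta>) * (rscalar (inverse \<beta>) * (p * (1 - p))) =
      (rscalar s2 + rscalar (inverse \<beta>) * (p - ?\<alpha>)) * (1 - rscalar (inverse \<beta>) * (p - ?\<alpha>))"
    for p :: "sphere_gen free_salg"
  proof -
    have "1 - rscalar (inverse \<beta>) * (p - ?\<alpha>) = rscalar (inverse \<beta>) * (1 - p)"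
    proof -
      have "rscalar (inverse \<beta>) * (1 - ?\<alpha>) = (1 :: sphere_gen free_salg)"
        unfolding one by (fact inv)
      then show ?thesis
        by (simp add: algebra_simps)
    qed
    moreover have "rscalar s2 + rscalar (inverse \<beta>) * (p - ?\<alpha>) = rscalar (inverse \<beta>) * p"
      by (simp add: s' algebra_simps)
    ultimately show ?thesis
      by (simp only: mult.assoc scalar_left_central[of p])
  qed
  have "rel_eq ?P (ev f l) (ev f r)" if "(l, r) \<in> ?Q" for l r
    using that
  proof (rule rel_eq_ev_qfuzzy; unfold f)
    show "rel_eq ?P (?\<alpha> + rscalar \<beta> * ?x) ((?\<alpha> + rscalar \<beta> * ?x)\<^sup>\<star>)"
      using P(1) by (simp add: scalar_left rel_eq_add rel_eq_scale)
    have "rel_eq ?P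
        ((?q - 1) * ?\<alpha> * (rscalar \<beta> * ?z) + rscalar \<beta> * (rscalar \<beta> * (?q * ?x * ?z - ?z * ?x)))
        ((?q - 1) * ?\<alpha> * (rscalar \<beta> * ?z) + rscalar \<beta> * (rscalar \<beta> * (?q * ?x * ?z - ?q * ?x * ?z)))"
      by (intro rel_eq_add rel_eq_scale rel_eq_diff rel_eq_refl P)
    then show "rel_eq ?P
        (?q * (?\<alpha> + rscalar \<beta> * ?x) * (rscalar \<beta> * ?z) - rscalar \<beta> * ?z * (?\<alpha> + rscalar \<beta> * ?x))
        (rscalar ((q2 - 1) * \<alpha>) * (rscalar \<beta> * ?z))"
      by (simp add: salg_simps)
    have "(?q * (?\<alpha> + rscalar \<beta> * ?x) - rscalar ((q2 - 1) * \<alpha>)) *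
        (1 + rscalar ((q2 - 1) * \<alpha>) - ?q * (?\<alpha> + rscalar \<beta> * ?x)) =
        (?\<alpha> + rscalar \<beta> * (?q * ?x)) * (1 - (?\<alpha> + rscalar \<beta> * (?q * ?x)))"
    proof -
      \<comment> \<open>As \<open>lam = (q2 - 1) \<alpha>\<close>, the shift by \<open>lam\<close>
        lowers the constant term \<open>q2 \<alpha>\<close> to \<open>\<alpha>\<close>.\<close>
      have "?q * (?\<alpha> + rscalar \<beta> * ?x) - rscalar ((q2 - 1) * \<alpha>) = ?\<alpha> + rscalar \<beta> * (?q * ?x)"
        by (simp add: salg_simps)
      then show ?thesis
        by (simp only: diff_diff_eq2[symmetric])
    qed
    moreover have "rscalar \<beta> * ?z * (rscalar \<beta> * ?z)\<^sup>\<star> = rscalar \<beta> * (rscalar \<beta> * (?z * ?z\<^sup>\<star>))"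
      by (simp add: salg_simps)
    ultimately show "rel_eq ?P (rscalar \<beta> * ?z * (rscalar \<beta> * ?z)\<^sup>\<star>)
        ((?q * (?\<alpha> + rscalar \<beta> * ?x) - rscalar ((q2 - 1) * \<alpha>)) *
        (1 + rscalar ((q2 - 1) * \<alpha>) - ?q * (?\<alpha> + rscalar \<beta> * ?x)))"
      by (simp only: scale[symmetric] rel_eq_scale P(3))
    have "(rscalar \<beta> * ?z)\<^sup>\<star> * (rscalar \<beta> * ?z) = rscalar \<beta> * (rscalar \<beta> * (?z\<^sup>\<star> * ?z))"
      by (simp add: salg_simps)
    then show "rel_eq ?P ((rscalar \<beta> * ?z)\<^sup>\<star> * (rscalar \<beta> * ?z))
        ((?\<alpha> + rscalar \<beta> * ?x) * (1 - (?\<alpha> + rscalar \<beta> * ?x)))"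
      by (simp only: scale[symmetric] rel_eq_scale P(4))
  qed
  moreover have "rel_eq ?Q (ev g l) (ev g r)" if "(l, r) \<in> ?P" for l r
    using that
  proof (rule rel_eq_ev_podles; unfold g)
    let ?i = "rscalar (inverse \<beta>)"
    show "rel_eq ?Q (?i * (?a - ?\<alpha>)) ((?i * (?a - ?\<alpha>))\<^sup>\<star>)"
      using Q(1) scalar_central[of "(?a)\<^sup>\<star> - ?\<alpha>"] by (simp add: rel_eq_diff rel_eq_scale)
    \<comment> \<open>Up to the scalar factor, the left side collapses to
      \<open>b (a - \<alpha>)\<close> and the right side to
      \<open>q2 (a - \<alpha>) b\<close>.\<close>
    have "rel_eq ?Q (?i * (?i * (?q * (?a - ?\<alpha>) * ?b - (?q * ?a * ?b - ?b * ?a) + (?q - 1) * ?\<alpha> * ?b)))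
        (?i * (?i * (?q * (?a - ?\<alpha>) * ?b - rscalar ((q2 - 1) * \<alpha>) * ?b + (?q - 1) * ?\<alpha> * ?b)))"
      by (intro rel_eq_add rel_eq_scale rel_eq_diff rel_eq_refl Q)
    then show "rel_eq ?Q (?i * ?b * (?i * (?a - ?\<alpha>))) (?q * (?i * (?a - ?\<alpha>)) * (?i * ?b))"
      by (simp add: salg_simps)
    \<comment> \<open>In terms of \<open>?p\<close> the relation for \<open>b * adj b\<close> has
      right side \<open>?p (1 - ?p)\<close>, the same shape as for \<open>adj b * b\<close>, and
      \<open>?p - \<alpha> = q2 (a - \<alpha>)\<close>.\<close>
    let ?p = "?q * ?a - rscalar ((q2 - 1) * \<alpha>)"
    have "?q * (?i * (?a - ?\<alpha>)) = ?i * (?p - ?\<alpha>)"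
      by (simp add: salg_simps)
    moreover have "?i * ?b * (?i * ?b)\<^sup>\<star> = ?i * (?i * (?b * ?b\<^sup>\<star>))"
      by (simp add: salg_simps)
    moreover have "rel_eq ?Q (?b * ?b\<^sup>\<star>) (?p * (1 - ?p))"
      using Q(3) by (simp only: diff_diff_eq2)
    ultimately show "rel_eq ?Q (?i * ?b * (?i * ?b)\<^sup>\<star>)
        ((rscalar s2 + ?q * (?i * (?a - ?\<alpha>))) * (1 - ?q * (?i * (?a - ?\<alpha>))))"
      by (simp only: scale'[symmetric] rel_eq_scale)
    have "(?i * ?b)\<^sup>\<star> * (?i * ?b) = ?i * (?i * (?b\<^sup>\<star> * ?b))"
      by (simp add: salg_simps)
    then show "rel_eq ?Q ((?i * ?b)\<^sup>\<star> * (?i * ?b))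
        ((rscalar s2 + ?i * (?a - ?\<alpha>)) * (1 - ?i * (?a - ?\<alpha>)))"
      by (simp only: scale'[symmetric] rel_eq_scale Q(4))
  qed
  moreover have "ev g (f y) = gen y" for y
    by (cases y) (simp_all add: inv')
  moreover have "ev f (g y) = gen y" for y
    by (cases y) (simp_all add: inv')
  moreover have "podles_sphere q2 s2 = presented ?P"
    by (simp add: podles_sphere_def podles_rels_def Let_def)
  ultimately show ?thesis
    unfolding qfuzzy_sphere_def using presented_isomorphic[of ?Q ?P f g] by simp
qed


section \<open>The fuzzy sphere\<close>

definition fuzzy_rels :: "real \<Rightarrow> fuzzy_gen relations" where
  "fuzzy_rels lam =
     {(gen i, (gen i)\<^sup>\<star>) | i. True} \<union>
     {(gen i * gen j - gen j * gen i,
       scalar (- (\<i> * complex_of_real lam)) * (\<Sum>k\<in>{X1, X2, X3}. scalar (eps i j k) * gen k))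
      | i j. True} \<union>
     {(\<Sum>i\<in>{X1, X2, X3}. gen i * gen i, rscalar ((1 - lam\<^sup>2) / 4))}"

lemma fuzzy_rel_eqs:
  shows "rel_eq (fuzzy_rels lam) (gen i) ((gen i)\<^sup>\<star>)"
    and "rel_eq (fuzzy_rels lam) (gen X1 * gen X2 - gen X2 * gen X1) (- (scalar \<i> * (rscalar lam * gen X3)))"
    and "rel_eq (fuzzy_rels lam) (gen X2 * gen X3 - gen X3 * gen X2) (- (scalar \<i> * (rscalar lam * gen X1)))"
    and "rel_eq (fuzzy_rels lam) (gen X3 * gen X1 - gen X1 * gen X3) (- (scalar \<i> * (rscalar lam * gen X2)))"
    and "rel_eq (fuzzy_rels lam) (gen X1 * gen X1 + gen X2 * gen X2 + gen X3 * gen X3)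
      (rscalar ((1 - lam\<^sup>2) / 4))"
proof -
  have *: "rel_eq (fuzzy_rels lam) (gen i * gen j - gen j * gen i)
      (scalar (- (\<i> * complex_of_real lam)) * (\<Sum>k\<in>{X1, X2, X3}. scalar (eps i j k) * gen k))" for i j
    by (rule rel_eq_rel) (auto simp: fuzzy_rels_def)
  show "rel_eq (fuzzy_rels lam) (gen i) ((gen i)\<^sup>\<star>)"
    by (rule rel_eq_rel) (auto simp: fuzzy_rels_def)
  show "rel_eq (fuzzy_rels lam) (gen X1 * gen X2 - gen X2 * gen X1) (- (scalar \<i> * (rscalar lam * gen X3)))"
    using *[of X1 X2] by (simp add: eps_def scalar_uminus scalar_mult mult.assoc)
  show "rel_eq (fuzzy_rels lam) (gen X2 * gen X3 - gen X3 * gen X2) (- (scalar \<i> * (rscalar lam * gen X1)))"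
    using *[of X2 X3] by (simp add: eps_def scalar_uminus scalar_mult mult.assoc)
  show "rel_eq (fuzzy_rels lam) (gen X3 * gen X1 - gen X1 * gen X3) (- (scalar \<i> * (rscalar lam * gen X2)))"
    using *[of X3 X1] by (simp add: eps_def scalar_uminus scalar_mult mult.assoc)
  have "rel_eq (fuzzy_rels lam) (\<Sum>i\<in>{X1, X2, X3}. gen i * gen i) (rscalar ((1 - lam\<^sup>2) / 4))"
    by (rule rel_eq_rel) (auto simp: fuzzy_rels_def)
  then show "rel_eq (fuzzy_rels lam) (gen X1 * gen X1 + gen X2 * gen X2 + gen X3 * gen X3)
      (rscalar ((1 - lam\<^sup>2) / 4))"
    by (simp add: add.assoc)
qed

text \<open>The three cyclic commutators suffice: equal indices make both sides zero, and reversed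
  indices negate both sides.\<close>

lemma rel_eq_ev_fuzzy:
  assumes "(l, r) \<in> fuzzy_rels lam"
    and "\<And>i. rel_eq R (y i) ((y i)\<^sup>\<star>)"
    and "rel_eq R (y X1 * y X2 - y X2 * y X1) (- (scalar \<i> * (rscalar lam * y X3)))"
    and "rel_eq R (y X2 * y X3 - y X3 * y X2) (- (scalar \<i> * (rscalar lam * y X1)))"
    and "rel_eq R (y X3 * y X1 - y X1 * y X3) (- (scalar \<i> * (rscalar lam * y X2)))"
    and "rel_eq R (y X1 * y X1 + y X2 * y X2 + y X3 * y X3) (rscalar ((1 - lam\<^sup>2) / 4))"
  shows "rel_eq R (ev y l) (ev y r)"
proof -
  consider i where "l = gen i" "r = (gen i)\<^sup>\<star>"
    | i j where "l = gen i * gen j - gen j * gen i"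
      "r = scalar (- (\<i> * complex_of_real lam)) * (\<Sum>k\<in>{X1, X2, X3}. scalar (eps i j k) * gen k)"
    | "l = (\<Sum>i\<in>{X1, X2, X3}. gen i * gen i)" "r = rscalar ((1 - lam\<^sup>2) / 4)"
    using assms(1) unfolding fuzzy_rels_def by blast
  then show ?thesis
  proof cases
    case 1
    then show ?thesis
      using assms(2) by simp
  next
    case (2 i j)
    show ?thesis
      using assms(3-5)[THEN rel_eq_uminus] assms(3-5) unfolding 2
      by (cases i; cases j) (simp_all add: eps_def scalar_uminus scalar_mult mult.assoc)
  next
    case 3
    then show ?thesis
      using assms(6) by (simp add: add.assoc)
  qed
qed

lemma rscalar_double_diff: "rscalar (2 * c - 1) = rscalar c + rscalar c - 1"
  by (simp only: mult_2 of_real_diff of_real_add of_real_1 scalar_expand scalar_1)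

lemma rscalar_radius: "rscalar ((1 - (2 * c - 1)\<^sup>2) / 4) = rscalar c * (1 - rscalar c)"
proof -
  have "(1 - (2 * c - 1)\<^sup>2) / 4 = c * (1 - c)"
    by (simp add: power2_eq_square field_simps)
  then show ?thesis
    by (simp add: scalar_expand)
qed

text \<open>The paper's \<open>\<lambda>\<close> is written as \<open>2 c - 1\<close>, so that \<open>a = c + x\<^sub>3\<close> and \<open>(1 - \<lambda>\<^sup>2) / 4 = c (1 - c)\<close>.\<close>

lemma qfuzzy_fuzzy: "qfuzzy_sphere 1 (2 * c - 1) \<cong>\<^sub>\<star> fuzzy_sphere (2 * c - 1)"
proof -
  let ?lam = "2 * c - 1"
  let ?Q = "qfuzzy_rels 1 ?lam" and ?F = "fuzzy_rels ?lam"
  let ?a = "gen Gen_a" and ?b = "gen Gen_b"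
  let ?x1 = "gen X1" and ?x2 = "gen X2" and ?x3 = "gen X3" and ?h = "scalar (1/2)" and ?i = "scalar \<i>"
  define f where "f y = (case y of Gen_a \<Rightarrow> rscalar c + ?x3 | Gen_b \<Rightarrow> ?x1 - ?i * ?x2)" for y
  \<comment> \<open>Solving \<open>b = x1 - i x2\<close> and \<open>adj b = x1 + i x2\<close> for
    \<open>x1\<close> and \<open>x2\<close>.\<close>
  define g where "g y = (case y of X1 \<Rightarrow> ?h * (?b + ?b\<^sup>\<star>) | X2 \<Rightarrow> ?i * (?h * (?b - ?b\<^sup>\<star>))
    | X3 \<Rightarrow> ?a - rscalar c)" for y
  have f [simp]: "f Gen_a = rscalar c + ?x3" "f Gen_b = ?x1 - ?i * ?x2"
    by (simp_all add: f_def)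
  have g [simp]: "g X1 = ?h * (?b + ?b\<^sup>\<star>)" "g X2 = ?i * (?h * (?b - ?b\<^sup>\<star>))" "g X3 = ?a - rscalar c"
    by (simp_all add: g_def)
  note lam = rscalar_double_diff[of c] and radius = rscalar_radius[of c]
  note Q = qfuzzy_rel_eqs[of 1 ?lam, simplified lam, simplified]
  note F = fuzzy_rel_eqs[of ?lam, unfolded radius lam]
  \<comment> \<open>The generators are self-adjoint only modulo the relations, so the adjoint of
    \<open>f Gen_b\<close> computed in the free algebra still contains adjoints of generators, which
    are removed here.\<close>
  have bs: "rel_eq ?F (?x1\<^sup>\<star> + ?i * ?x2\<^sup>\<star>) (?x1 + ?i * ?x2)"
    by (intro rel_eq_add rel_eq_scale rel_eq_sym[OF F(1)])
  have 1: "rel_eq ?F (ev f l) (ev f r)" if "(l, r) \<in> ?Q" for l r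
    using that
  proof (rule rel_eq_ev_qfuzzy; unfold f lam)
    show "rel_eq ?F (rscalar c + ?x3) ((rscalar c + ?x3)\<^sup>\<star>)"
      using F(1) by (simp add: rel_eq_add)
    show "rel_eq ?F (rscalar 1 * (rscalar c + ?x3) * (?x1 - ?i * ?x2) - (?x1 - ?i * ?x2) * (rscalar c + ?x3))
        ((rscalar c + rscalar c - 1) * (?x1 - ?i * ?x2))"
      \<comment> \<open>\<open>[x3, x1 - i x2] = [x3, x1] + i [x2, x3]\<close>, which is congruent
        to \<open>lam (x1 - i x2)\<close>.\<close>
      using rel_eq_add[OF F(4) rel_eq_scale[OF F(3), of \<i>]] by (simp add: salg_simps)
    have star: "(?x1 - ?i * ?x2)\<^sup>\<star> = ?x1\<^sup>\<star> + ?i * ?x2\<^sup>\<star>"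
      by (simp add: scalar_left scalar_uminus)
    have "rel_eq ?F ((?x1 - ?i * ?x2) * (?x1\<^sup>\<star> + ?i * ?x2\<^sup>\<star>)) ((?x1 - ?i * ?x2) * (?x1 + ?i * ?x2))"
      by (intro rel_eq_mult bs rel_eq_refl)
    also have "rel_eq ?F \<dots> ((rscalar 1 * (rscalar c + ?x3) - (rscalar c + rscalar c - 1)) *
        (1 + (rscalar c + rscalar c - 1) - rscalar 1 * (rscalar c + ?x3)))"
      \<comment> \<open>The product is \<open>x1^2 + x2^2 + i [x1, x2]\<close>, congruent to
        \<open>c (1 - c) - x3^2 + lam x3\<close>, which factors as claimed. The reverse order below
        changes the sign of the commutator.\<close>
      using rel_eq_diff[OF rel_eq_add[OF F(5) rel_eq_scale[OF F(2), of \<i>]] rel_eq_refl, of "?x3 * ?x3"]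
      by (simp add: salg_simps)
    finally show "rel_eq ?F ((?x1 - ?i * ?x2) * (?x1 - ?i * ?x2)\<^sup>\<star>)
        ((rscalar 1 * (rscalar c + ?x3) - (rscalar c + rscalar c - 1)) *
        (1 + (rscalar c + rscalar c - 1) - rscalar 1 * (rscalar c + ?x3)))"
      unfolding star .
    have "rel_eq ?F ((?x1\<^sup>\<star> + ?i * ?x2\<^sup>\<star>) * (?x1 - ?i * ?x2)) ((?x1 + ?i * ?x2) * (?x1 - ?i * ?x2))"
      by (intro rel_eq_mult bs rel_eq_refl)
    also have "rel_eq ?F \<dots> ((rscalar c + ?x3) * (1 - (rscalar c + ?x3)))"
      using rel_eq_diff[OF rel_eq_diff[OF F(5) rel_eq_scale[OF F(2), of \<i>]] rel_eq_refl, of "?x3 * ?x3"]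
      by (simp add: salg_simps)
    finally show "rel_eq ?F ((?x1 - ?i * ?x2)\<^sup>\<star> * (?x1 - ?i * ?x2))
        ((rscalar c + ?x3) * (1 - (rscalar c + ?x3)))"
      unfolding star .
  qed
  have 2: "rel_eq ?Q (ev g l) (ev g r)" if "(l, r) \<in> ?F" for l r
    using that
  proof (rule rel_eq_ev_fuzzy)
    \<comment> \<open>The adjoint of the commutation relation, with \<open>adj a\<close> replaced by
      \<open>a\<close>.\<close>
    have star: "rel_eq ?Q (?b\<^sup>\<star> * ?a - ?a * ?b\<^sup>\<star>) (rscalar ?lam * ?b\<^sup>\<star>)"
    proof -
      have "rel_eq ?Q (?b\<^sup>\<star> * ?a - ?a * ?b\<^sup>\<star>) (?b\<^sup>\<star> * ?a\<^sup>\<star> - ?a\<^sup>\<star> * ?b\<^sup>\<star>)"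
        by (intro rel_eq_diff rel_eq_mult Q rel_eq_refl)
      also have "rel_eq ?Q \<dots> (rscalar ?lam * ?b\<^sup>\<star>)"
        using rel_eq_adj[OF Q(2)] unfolding lam by (simp add: salg_simps)
      finally show ?thesis .
    qed
    show "rel_eq ?Q (g i) ((g i)\<^sup>\<star>)" for i
    proof (cases i)
      case X3
      then show ?thesis
        using Q(1) by (simp add: rel_eq_diff)
    qed (simp_all add: salg_simps)
    \<comment> \<open>Normalisation keeps \<open>?h\<close> as a symbol, so coefficients are
      arranged to contain \<open>?h + ?h\<close>, which this equation removes.\<close>
    have half: "?h + ?h = (1 :: sphere_gen free_salg)"
      using scalar_half_add[of 1] by simp
    \<comment> \<open>Half of \<open>a (1 - a) - (a - lam) (1 + lam - a)\<close>, to which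
      \<open>adj b * b - b * adj b\<close> reduces; it equals \<open>- lam (a - c)\<close>.\<close>
    let ?D = "(?a - rscalar c) * (1 - rscalar c - rscalar c)"
    have "g X1 * g X2 - g X2 * g X1 = ?i * (?h * ((?h + ?h) * (?b\<^sup>\<star> * ?b - ?b * ?b\<^sup>\<star>)))"
      by (simp add: salg_simps)
    also have "\<dots> = ?i * (?h * (?b\<^sup>\<star> * ?b - ?b * ?b\<^sup>\<star>))"
      by (simp only: half mult_1_left)
    also have "rel_eq ?Q \<dots> (?i * (?h * (?D + ?D)))"
    proof -
      have "?D + ?D =
          ?a * (1 - ?a) - (?a - (rscalar c + rscalar c - 1)) * (1 + (rscalar c + rscalar c - 1) - ?a)"
        by (simp add: salg_simps)
      then show ?thesis
        using rel_eq_diff[OF Q(4,3)] by (simp add: rel_eq_scale)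
    qed
    also have "?h * (?D + ?D) = ?D"
      using scalar_half_add[of ?D] by (simp only: distrib_left)
    also have "?i * ?D = - (?i * (rscalar ?lam * g X3))"
      unfolding lam by (simp add: salg_simps)
    finally show "rel_eq ?Q (g X1 * g X2 - g X2 * g X1) (- (?i * (rscalar ?lam * g X3)))" .
    show "rel_eq ?Q (g X2 * g X3 - g X3 * g X2) (- (?i * (rscalar ?lam * g X1)))"
      \<comment> \<open>\<open>[x2, x3]\<close> is \<open>- i / 2\<close> times the sum of
        \<open>[a, b]\<close> and \<open>[adj b, a]\<close>; \<open>[x3, x1]\<close> below is half
        their difference.\<close>
      using rel_eq_scale[OF rel_eq_scale[OF
          rel_eq_uminus[OF rel_eq_add[OF Q(2) star[unfolded lam]]], of "1/2"], of \<i>]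
      unfolding lam by (simp add: salg_simps)
    show "rel_eq ?Q (g X3 * g X1 - g X1 * g X3) (- (?i * (rscalar ?lam * g X2)))"
      using rel_eq_scale[OF rel_eq_diff[OF Q(2) star[unfolded lam]], of "1/2"]
      unfolding lam by (simp add: salg_simps)
    \<comment> \<open>The value of \<open>x1^2 + x2^2\<close>, namely half of
      \<open>adj b * b + b * adj b\<close>; adding \<open>x3^2 = (a - c)^2\<close> leaves
      \<open>c (1 - c)\<close>.\<close>
    let ?V = "rscalar c * (1 - rscalar c) - (?a - rscalar c) * (?a - rscalar c)"
    have "g X1 * g X1 + g X2 * g X2 + g X3 * g X3 =
        ?h * ((?h + ?h) * (?b\<^sup>\<star> * ?b + ?b * ?b\<^sup>\<star>)) + g X3 * g X3"
      by (simp add: salg_simps)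
    also have "\<dots> = ?h * (?b\<^sup>\<star> * ?b + ?b * ?b\<^sup>\<star>) + g X3 * g X3"
      by (simp only: half mult_1_left)
    also have "rel_eq ?Q \<dots> (?h * (?V + ?V) + g X3 * g X3)"
    proof -
      have "?V + ?V =
          ?a * (1 - ?a) + (?a - (rscalar c + rscalar c - 1)) * (1 + (rscalar c + rscalar c - 1) - ?a)"
        by (simp add: salg_simps)
      then show ?thesis
        using rel_eq_add[OF Q(4,3)] by (simp add: rel_eq_scale rel_eq_add)
    qed
    also have "?h * (?V + ?V) = ?V"
      using scalar_half_add[of ?V] by (simp only: distrib_left)
    finally show "rel_eq ?Q (g X1 * g X1 + g X2 * g X2 + g X3 * g X3) (rscalar ((1 - ?lam\<^sup>2) / 4))"
      unfolding radius by simp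
  qed
  have "rel_eq ?Q (ev g (f y)) (gen y)" for y
    using scalar_half_add[of "?b"] by (cases y) (simp_all add: salg_simps)
  moreover have "rel_eq ?F (ev f (g y)) (gen y)" for y
  proof (cases y)
    case X1
    have "rel_eq ?F (?h * (?x1 + (?x1\<^sup>\<star> + ?i * ?x2\<^sup>\<star>) - ?i * ?x2)) (?h * (?x1 + (?x1 + ?i * ?x2) - ?i * ?x2))"
      by (intro rel_eq_scale rel_eq_add rel_eq_diff bs rel_eq_refl)
    with X1 show ?thesis
      using scalar_half_add[of "?x1"] by (simp add: salg_simps)
  next
    case X2
    have "rel_eq ?F (?i * (?h * (?x1 - ?i * ?x2 - (?x1\<^sup>\<star> + ?i * ?x2\<^sup>\<star>)))) (?i * (?h * (?x1 - ?i * ?x2 - (?x1 + ?i * ?x2))))"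
      by (intro rel_eq_scale rel_eq_diff bs rel_eq_refl)
    with X2 show ?thesis
      using scalar_half_add[of "?x2"] by (simp add: salg_simps)
  qed simp
  moreover have "fuzzy_sphere ?lam = presented ?F"
    by (simp add: fuzzy_sphere_def fuzzy_rels_def)
  ultimately show ?thesis
    unfolding qfuzzy_sphere_def using presented_isomorphic[of ?Q ?F f g] 1 2 by simp
qed

section \<open>Assembly of the four claims\<close>

theorem proposition1:
  fixes q2 lam :: real
  assumes "q2 \<noteq> 0"
  shows
    "(q2 = 1 \<longrightarrow> qfuzzy_sphere q2 lam \<cong>\<^sub>\<star> fuzzy_sphere lam) \<and>
     (lam = 0 \<or> lam = q2 - 1 \<longrightarrow> qfuzzy_sphere q2 lam \<cong>\<^sub>\<star> standard_sphere q2) \<and>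
     (q2 \<noteq> 1 \<and> lam \<noteq> 0 \<and> lam \<noteq> q2 - 1 \<longrightarrow>
        (let s2 = lam / (q2 - 1 - lam) in
           s2 \<noteq> 0 \<and> qfuzzy_sphere q2 lam \<cong>\<^sub>\<star> podles_sphere q2 s2 \<and>
           ((\<exists>s::real. s\<^sup>2 = s2) \<longrightarrow> min 0 (q2 - 1) < lam \<and> lam < max 0 (q2 - 1)))) \<and>
     (\<exists>h \<in> star_alg_iso (qfuzzy_sphere q2 lam) (qfuzzy_sphere q2 (q2 - 1 - lam)).
        h (cls (qfuzzy_rels q2 lam) (gen Gen_b)) =
          cls (qfuzzy_rels q2 (q2 - 1 - lam)) (gen Gen_b) \<and>
        h (cls (qfuzzy_rels q2 lam) (gen Gen_a)) =
          cls (qfuzzy_rels q2 (q2 - 1 - lam)) (1 - gen Gen_a))"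
proof (intro conjI impI)
  assume q2: "q2 = 1"
  have lam: "2 * ((1 + lam) / 2) - 1 = lam"
    by (simp add: field_simps)
  show "qfuzzy_sphere q2 lam \<cong>\<^sub>\<star> fuzzy_sphere lam"
    using qfuzzy_fuzzy[of "(1 + lam) / 2"] unfolding lam q2 .
next
  have flip: "qfuzzy_sphere q2 (q2 - 1) \<cong>\<^sub>\<star> qfuzzy_sphere q2 0"
    using qfuzzy_flip_iso[of q2 "q2 - 1"] by (auto simp: star_alg_isomorphic_def)
  assume "lam = 0 \<or> lam = q2 - 1"
  then show "qfuzzy_sphere q2 lam \<cong>\<^sub>\<star> standard_sphere q2"
    using qfuzzy_0_standard star_alg_isomorphic_trans[OF flip] by auto
next
  assume lam: "q2 \<noteq> 1 \<and> lam \<noteq> 0 \<and> lam \<noteq> q2 - 1"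
  define \<alpha> where "\<alpha> = lam / (q2 - 1)"
  have "\<alpha> \<noteq> 1" "lam = (q2 - 1) * \<alpha>" "\<alpha> / (1 - \<alpha>) = lam / (q2 - 1 - lam)"
    using lam by (auto simp: \<alpha>_def divide_simps)
  then have "qfuzzy_sphere q2 lam \<cong>\<^sub>\<star> podles_sphere q2 (lam / (q2 - 1 - lam))"
    using qfuzzy_podles[of \<alpha> q2] by simp
  moreover have "min 0 (q2 - 1) < lam \<and> lam < max 0 (q2 - 1)" if "s\<^sup>2 = lam / (q2 - 1 - lam)" for s :: real
  proof -
    \<comment> \<open>A nonnegative quotient of nonzero reals forces \<open>lam\<close> and
      \<open>q2 - 1 - lam\<close> to have the same sign, so \<open>lam\<close> lies strictly between
      \<open>0\<close> and \<open>q2 - 1\<close>.\<close>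
    have "0 \<le> lam / (q2 - 1 - lam)"
      by (metis that zero_le_power2)
    then show ?thesis
      using lam by (auto simp: zero_le_divide_iff)
  qed
  ultimately show "let s2 = lam / (q2 - 1 - lam) in
      s2 \<noteq> 0 \<and> qfuzzy_sphere q2 lam \<cong>\<^sub>\<star> podles_sphere q2 s2 \<and>
      ((\<exists>s::real. s\<^sup>2 = s2) \<longrightarrow> min 0 (q2 - 1) < lam \<and> lam < max 0 (q2 - 1))"
    using lam by (auto simp: Let_def)
next
  show "\<exists>h \<in> star_alg_iso (qfuzzy_sphere q2 lam) (qfuzzy_sphere q2 (q2 - 1 - lam)).
      h (cls (qfuzzy_rels q2 lam) (gen Gen_b)) =
        cls (qfuzzy_rels q2 (q2 - 1 - lam)) (gen Gen_b) \<and>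
      h (cls (qfuzzy_rels q2 lam) (gen Gen_a)) =
        cls (qfuzzy_rels q2 (q2 - 1 - lam)) (1 - gen Gen_a)"
    using qfuzzy_flip_iso[of q2 lam] by (elim bexE, intro bexI conjI) simp_all
qed

end
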